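(* One has $n_0(3)=8$.
   Context: For a positive integer $n$ write $[n]=\{1,\dots,n\}$. For a family $\mathcal F\subseteq 2^{[n]}$ write $S(\mathcal F)=\{|A| : A\in\mathcal F\}$ and $\mathcal F_t=\{A\in\mathcal F : |A|=t\}$ for $t=0,1,\dots,n$. Given an integer $r\ge 1$, $\mathcal F$ is called an $r$-multiplicity antichain if (i) $A\not\subseteq B$ for all distinct $A,B\in\mathcal F$, and (ii) $|\mathcal F_t|\ge r$ for every $t\in S(\mathcal F)$. For integers $n,r\ge 1$ define $$g(n,r)=\max\{|S(\mathcal F)| : \mathcal F\subseteq 2^{[n]} \text{ is an } r\text{-multiplicity antichain}\}.$$ For an integer $r\ge 2$, $n_0(r)$ denotes the smallest integer $n_0$ such that $g(n,r)=n-3$ for every integer $n>n_0$. *)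

theory Defs
  imports Main
begin

definition sizes :: "nat set set \<Rightarrow> nat set" where
  "sizes F = card ` F"

definition layer :: "nat set set \<Rightarrow> nat \<Rightarrow> nat set set" where
  "layer F t = {A \<in> F. card A = t}"

definition multiplicity_antichain :: "nat \<Rightarrow> nat set set \<Rightarrow> bool" where
  "multiplicity_antichain r F \<longleftrightarrow>
     (\<forall>A\<in>F. \<forall>B\<in>F. A \<noteq> B \<longrightarrow> \<not> A \<subseteq> B) \<and>
     (\<forall>t\<in>sizes F. card (layer F t) \<ge> r)"

definition g :: "nat \<Rightarrow> nat \<Rightarrow> nat" where
  "g n r = Max {card (sizes F) | F. F \<subseteq> Pow {1..n} \<and> multiplicity_antichain r F}"

text \<open>The difference is taken in the integers: with truncated subtraction the equation
  would become satisfiable for small \<open>n\<close>.  Restricting the thresholds to natural numbers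
  loses nothing, since \<open>g n r\<close> is only meant for positive \<open>n\<close>.\<close>

definition threshold :: "nat \<Rightarrow> nat \<Rightarrow> bool" where
  "threshold r m \<longleftrightarrow> (\<forall>n>m. int (g n r) = int n - 3)"

definition n0 :: "nat \<Rightarrow> nat" where
  "n0 r = (LEAST m. threshold r m)"

end

theory Submission imports Defs
begin

text \<open>
  An antichain with at least three sets in each layer cannot use the sizes \<open>0\<close> and \<open>n\<close>, and three
  singletons confine the other members to \<open>n - 3\<close> points; up to complements this leaves at most the
  sizes \<open>2, \<dots>, n - 2\<close>.  For \<open>n = 8\<close> these five sizes cannot all occur: the pairs and the complements
  of the \<open>6\<close>-sets are cross-intersecting, and a \<open>3\<close>-set forces them to be stars with a common centre
  \<open>x\<close>.  Then at most one \<open>4\<close>-set contains \<open>x\<close> and, by complementation, at most one avoids it.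

  For \<open>n \<ge> 9\<close> the sizes \<open>2, \<dots>, n - 2\<close> are realised by adding a new point to all members of an
  antichain of small sets and joining it with an antichain of larger sets on the old points.
  Taking disjoint singletons into the small part and the complements of such families as the large
  part leads from \<open>n\<close> to \<open>n + 4\<close>, so that \<open>n = 9, 10, 11, 12\<close> suffice.
\<close>

section \<open>Antichains, layers and complementation inside \<open>{1..n}\<close>\<close>

definition antichain :: "nat set set \<Rightarrow> bool" where
  "antichain F \<longleftrightarrow> (\<forall>A\<in>F. \<forall>B\<in>F. A \<subseteq> B \<longrightarrow> A = B)"

definition co :: "nat \<Rightarrow> nat set set \<Rightarrow> nat set set" where
  "co n F = (\<lambda>A. {1..n} - A) ` F"

lemma antichainD: "antichain F \<Longrightarrow> A \<in> F \<Longrightarrow> B \<in> F \<Longrightarrow> A \<subseteq> B \<Longrightarrow> A = B"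
  unfolding antichain_def by blast

lemma multiplicity_antichain_iff:
  "multiplicity_antichain r F \<longleftrightarrow> antichain F \<and> (\<forall>t\<in>sizes F. r \<le> card (layer F t))"
  unfolding multiplicity_antichain_def antichain_def by blast

lemma in_PowD: "F \<subseteq> Pow V \<Longrightarrow> A \<in> F \<Longrightarrow> A \<subseteq> V"
  by blast

lemma layer_iff: "A \<in> layer F t \<longleftrightarrow> A \<in> F \<and> card A = t"
  by (simp add: layer_def)

lemma in_layerD: "F \<subseteq> Pow V \<Longrightarrow> A \<in> layer F t \<Longrightarrow> A \<subseteq> V"
  by (auto simp: layer_iff)

lemma finite_layer:
  assumes "F \<subseteq> Pow {1..n}" shows "finite (layer F t)"
proof -
  have "finite F" using assms finite_subset by (metis finite_Pow_iff finite_atLeastAtMost)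
  then show ?thesis by (simp add: layer_def)
qed

lemma co_subset: "co n F \<subseteq> Pow {1..n}"
  by (auto simp: co_def)

lemma compl_compl: "F \<subseteq> Pow {1..n} \<Longrightarrow> A \<in> F \<Longrightarrow> {1..n} - ({1..n} - A) = A"
  by (intro double_diff) auto

lemma co_inj: "F \<subseteq> Pow {1..n} \<Longrightarrow> inj_on (\<lambda>A. {1..n} - A) F"
  by (rule inj_on_inverseI[of _ "\<lambda>A. {1..n} - A"]) (rule compl_compl)

lemma antichain_co:
  assumes "F \<subseteq> Pow {1..n}" "antichain F"
  shows "antichain (co n F)"
  unfolding antichain_def co_def ball_simps
proof (intro ballI impI)
  fix A B assume AB: "A \<in> F" "B \<in> F" "{1..n} - A \<subseteq> {1..n} - B"
  have "{1..n} - ({1..n} - B) \<subseteq> {1..n} - ({1..n} - A)" by (rule Diff_mono[OF order_refl AB(3)])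
  then show "{1..n} - A = {1..n} - B"
    using AB compl_compl[OF assms(1)] antichainD[OF assms(2), of B A] by simp
qed

lemma card_compl: "A \<subseteq> {1..n} \<Longrightarrow> card ({1..n} - A) = n - card A"
  by (subst card_Diff_subset) (auto intro: finite_subset)

lemma card_le: "A \<subseteq> {1..n} \<Longrightarrow> card A \<le> n"
  using card_mono[of "{1..n}" A] by simp

lemma sizes_subset: "F \<subseteq> Pow {1..n} \<Longrightarrow> sizes F \<subseteq> {0..n}"
  using card_le[OF in_PowD] by (auto simp: sizes_def)

text \<open>The bound \<open>t \<le> n\<close> guards against truncated subtraction: for larger
  \<open>t\<close> the index \<open>n - t\<close> would collapse to 0.\<close>

lemma layer_co:
  assumes "F \<subseteq> Pow {1..n}" "t \<le> n"
  shows "layer (co n F) t = (\<lambda>A. {1..n} - A) ` layer F (n - t)"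
proof -
  have "card ({1..n} - A) = t \<longleftrightarrow> card A = n - t" if "A \<in> F" for A
    using card_compl[of A n] card_le[of A n] in_PowD[OF assms(1) that] assms(2) by auto
  then show ?thesis unfolding layer_def co_def by blast
qed

lemma card_layer_co:
  assumes "F \<subseteq> Pow {1..n}" "t \<le> n"
  shows "card (layer (co n F) t) = card (layer F (n - t))"
  unfolding layer_co[OF assms]
  by (rule card_image, rule inj_on_subset[OF co_inj[OF assms(1)]]) (auto simp: layer_def)

lemma sizes_co: "F \<subseteq> Pow {1..n} \<Longrightarrow> sizes (co n F) = (\<lambda>t. n - t) ` sizes F"
  unfolding sizes_def co_def image_image
  using card_compl[OF in_PowD] by (intro image_cong refl)

lemma card_ge_two: "2 \<le> card S \<Longrightarrow> \<exists>a\<in>S. \<exists>b\<in>S. a \<noteq> b"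
  by (metis One_nat_def card_le_Suc0_iff_eq card.infinite not_less_eq_eq numeral_2_eq_2 zero_le)

lemma multiplicity_antichain_co:
  assumes "F \<subseteq> Pow {1..n}" "multiplicity_antichain r F"
  shows "multiplicity_antichain r (co n F)"
proof -
  have "r \<le> card (layer (co n F) t)" if t: "t \<in> sizes (co n F)" for t
  proof -
    obtain s where s: "s \<in> sizes F" "t = n - s"
      using t sizes_co[OF assms(1)] by auto
    have "s \<le> n" using sizes_subset[OF assms(1)] s(1) by auto
    then show ?thesis
      using assms s card_layer_co[OF assms(1), of t] by (simp add: multiplicity_antichain_iff)
  qed
  then show ?thesis using assms antichain_co by (simp add: multiplicity_antichain_iff)
qed

subsection \<open>Upper bounds\<close>

text \<open>Only one finite set has cardinality 0. Finiteness of the members has to be secured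
  first, because \<open>card\<close> is 0 on infinite sets too.\<close>

lemma zero_notin_sizes:
  assumes "F \<subseteq> Pow {1..n}" "multiplicity_antichain 3 F"
  shows "0 \<notin> sizes F"
proof
  assume "0 \<in> sizes F"
  then have "3 \<le> card (layer F 0)" using assms by (simp add: multiplicity_antichain_iff)
  then obtain A B where "A \<in> layer F 0" "B \<in> layer F 0" "A \<noteq> B"
    using card_ge_two[of "layer F 0"] by auto
  moreover have "finite A" if "A \<in> F" for A
    using that assms(1) finite_subset[of A "{1..n}"] by auto
  ultimately show False by (auto simp: layer_iff)
qed

text \<open>Members of size other than 1 miss the points of \<open>U\<close>, of which there are at
  least three. Of two distinct members of equal size neither can be the whole complement of
  \<open>U\<close>, so their size is strictly below \<open>n - 3\<close>.\<close>

lemma sizes_with_singletons: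
  assumes F: "F \<subseteq> Pow {1..n}" "multiplicity_antichain 3 F" and "1 \<in> sizes F" "5 \<le> n"
  shows "sizes F \<subseteq> {1..n - 4}"
proof
  fix t assume t: "t \<in> sizes F"
  have ac: "antichain F" and mult: "\<And>t. t \<in> sizes F \<Longrightarrow> 3 \<le> card (layer F t)"
    using F by (auto simp: multiplicity_antichain_iff)
  define U where "U = {x. {x} \<in> F}"
  have "layer F 1 = (\<lambda>x. {x}) ` U"
    by (auto simp: layer_def U_def card_1_singleton_iff)
  then have "card (layer F 1) = card U"
    by (simp add: card_image)
  then have U3: "3 \<le> card U" using mult[OF assms(3)] by simp
  have Usub: "U \<subseteq> {1..n}" using F by (auto simp: U_def)
  have cU: "card ({1..n} - U) \<le> n - 3" using card_compl[OF Usub] U3 by simp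
  show "t \<in> {1..n - 4}"
  proof (cases "t = 1")
    case True then show ?thesis using assms by simp
  next
    case False
    have sub: "A \<subseteq> {1..n} - U" if "A \<in> layer F t" for A
    proof
      fix x assume x: "x \<in> A"
      have "x \<notin> U"
      proof
        assume "x \<in> U"
        then have "{x} = A" using antichainD[OF ac, of "{x}" A] that x by (auto simp: U_def layer_iff)
        then show False using that False by (auto simp: layer_iff)
      qed
      then show "x \<in> {1..n} - U" using in_layerD[OF F(1) that] x by blast
    qed
    obtain A B where AB: "A \<in> layer F t" "B \<in> layer F t" "A \<noteq> B"
      using card_ge_two[of "layer F t"] mult[OF t] by auto
    have "card A < card ({1..n} - U)"
    proof (rule psubset_card_mono)
      show "A \<subset> {1..n} - U"
        using sub[OF AB(1)] sub[OF AB(2)] AB antichainD[OF ac, of B A] unfolding layer_iff by blast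
    qed simp
    then have "t < n - 3" using cU AB by (simp add: layer_iff)
    moreover have "t \<noteq> 0" using t zero_notin_sizes[OF F] by metis
    ultimately show ?thesis by simp
  qed
qed

text \<open>Size 0 is impossible, hence so is \<open>n\<close> by passing to complements. Size 1, or
  after complementation size \<open>n - 1\<close>, brings in the bound for families with singletons;
  otherwise only the middle interval remains.\<close>

lemma sizes_dichotomy:
  assumes F: "F \<subseteq> Pow {1..n}" "multiplicity_antichain 3 F" and "5 \<le> n"
  shows "sizes F \<subseteq> {2..n - 2} \<or> card (sizes F) \<le> n - 4"
proof -
  let ?S = "sizes F"
  have S: "?S \<subseteq> {0..n}" by (rule sizes_subset[OF F(1)])
  have co: "co n F \<subseteq> Pow {1..n}" "multiplicity_antichain 3 (co n F)"
    using co_subset multiplicity_antichain_co[OF F] by auto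
  have n: "n \<notin> ?S" using zero_notin_sizes[OF co] sizes_co[OF F(1)] by force
  consider (one) "1 \<in> ?S" | (coone) "n - 1 \<in> ?S" | (mid) "1 \<notin> ?S" "n - 1 \<notin> ?S" by blast
  then show ?thesis
  proof cases
    case one
    from card_mono[OF _ sizes_with_singletons[OF F one assms(3)]] show ?thesis by simp
  next
    case coone
    then have "1 \<in> sizes (co n F)" using sizes_co[OF F(1)] assms(3) by force
    from card_mono[OF _ sizes_with_singletons[OF co this assms(3)]]
    have "card (sizes (co n F)) \<le> n - 4" by simp
    moreover have "inj_on (\<lambda>t. n - t) ?S" using S by (intro inj_onI) (metis atLeastAtMost_iff diff_diff_cancel subsetD)
    ultimately show ?thesis by (simp add: sizes_co[OF F(1)] card_image)
  next
    case mid
    have "?S \<subseteq> {2..n - 2}"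
    proof
      fix t assume t: "t \<in> ?S"
      then have "t \<noteq> 0" "t \<noteq> 1" "t \<noteq> n" "t \<noteq> n - 1" "t \<le> n"
        using zero_notin_sizes[OF F] n mid S by (metis | auto)+
      then show "t \<in> {2..n - 2}" by auto
    qed
    then show ?thesis ..
  qed
qed

lemma card_sizes_le:
  assumes "F \<subseteq> Pow {1..n}" "multiplicity_antichain 3 F" "5 \<le> n"
  shows "card (sizes F) \<le> n - 3"
  using sizes_dichotomy[OF assms] card_mono[of "{2..n - 2}" "sizes F"] by auto

subsection \<open>Eight points\<close>

lemma pair_eq: "card e = 2 \<Longrightarrow> x \<in> e \<Longrightarrow> y \<in> e \<Longrightarrow> x \<noteq> y \<Longrightarrow> e = {x, y}"
  by (auto simp: card_2_iff)

text \<open>The three pairs in \<open>H\<close> form a path through \<open>q'\<close>,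
  \<open>p\<close>, \<open>q\<close>, \<open>p'\<close> in this order. A third member
  \<open>e\<close> of \<open>G\<close> must meet all its edges, which leaves only
  \<open>{p, q}\<close>. Since \<open>T\<close> also meets these edges but contains neither
  \<open>{p, p'}\<close> nor \<open>{q, q'}\<close>, both \<open>p\<close> and \<open>q\<close> lie
  in \<open>T\<close>; then \<open>T\<close> contains \<open>e\<close>.\<close>

lemma no_disjoint_edges_aux:
  assumes G: "\<And>e. e \<in> G \<Longrightarrow> card e = 2" "{p, p'} \<in> G" "{q, q'} \<in> G" "3 \<le> card G"
    and Hc: "\<And>h. h \<in> H \<Longrightarrow> card h = 2"
    and H: "{p, q} \<in> H" "{p, q'} \<in> H" "{p', q} \<in> H"
    and cross: "\<And>e h. e \<in> G \<Longrightarrow> h \<in> H \<Longrightarrow> e \<inter> h \<noteq> {}"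
    and T: "\<And>e. e \<in> G \<Longrightarrow> \<not> e \<subseteq> T" "\<And>h. h \<in> H \<Longrightarrow> h \<inter> T \<noteq> {}"
  shows False
proof -
  have "card {{p, p'}, {q, q'}} \<le> 2" by (simp add: card_insert_if)
  then have "\<not> G \<subseteq> {{p, p'}, {q, q'}}"
    using G(4) card_mono[of "{{p, p'}, {q, q'}}" G] by auto
  then obtain e where e: "e \<in> G" "e \<noteq> {p, p'}" "e \<noteq> {q, q'}" by blast
  have "p \<noteq> p'" "q \<noteq> q'" using G(1)[OF G(2)] G(1)[OF G(3)] by auto
  have c: "card e = 2" using G(1) e by blast
  have hit: "p \<in> e \<or> q \<in> e" "p \<in> e \<or> q' \<in> e" "p' \<in> e \<or> q \<in> e"
    using cross[OF e(1)] H by auto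
  have pq: "p \<in> e" "q \<in> e"
    using hit pair_eq[OF c, of p p'] pair_eq[OF c, of q q'] e \<open>p \<noteq> p'\<close> \<open>q \<noteq> q'\<close> by blast+
  have "p \<in> T" "q \<in> T"
    using T(1)[OF G(2)] T(1)[OF G(3)] T(2)[OF H(1)] T(2)[OF H(2)] T(2)[OF H(3)] by auto
  moreover have "p \<noteq> q" using Hc[OF H(1)] by auto
  ultimately show False
    using T(1)[OF e(1)] pair_eq[OF c pq] by auto
qed


text \<open>If \<open>{a, b}\<close> and \<open>{c, d}\<close> were disjoint, every member of
  \<open>H\<close> would join one to the other. Then \<open>H\<close> would have at least three of
  the four edges of a 4-cycle, hence a path excluded by
  \<open>no_disjoint_edges_aux\<close>.\<close>

lemma no_disjoint_edges:
  assumes G: "\<And>e. e \<in> G \<Longrightarrow> card e = 2" "3 \<le> card G"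
    and H: "\<And>h. h \<in> H \<Longrightarrow> card h = 2" "3 \<le> card H"
    and cross: "\<And>e h. e \<in> G \<Longrightarrow> h \<in> H \<Longrightarrow> e \<inter> h \<noteq> {}"
    and T: "\<And>e. e \<in> G \<Longrightarrow> \<not> e \<subseteq> T" "\<And>h. h \<in> H \<Longrightarrow> h \<inter> T \<noteq> {}"
    and e: "e1 \<in> G" "e2 \<in> G"
  shows "e1 \<inter> e2 \<noteq> {}"
proof
  assume disj: "e1 \<inter> e2 = {}"
  obtain a b where ab: "e1 = {a, b}" "a \<noteq> b" using G(1)[OF e(1)] by (auto simp: card_2_iff)
  obtain c d where cd: "e2 = {c, d}" "c \<noteq> d" using G(1)[OF e(2)] by (auto simp: card_2_iff)
  let ?K = "{{a, c}, {a, d}, {b, c}, {b, d}}"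
  have HK: "H \<subseteq> ?K"
  proof
    fix h assume h: "h \<in> H"
    then have "a \<in> h \<or> b \<in> h" "c \<in> h \<or> d \<in> h"
      using cross[OF e(1) h] cross[OF e(2) h] ab cd by auto
    then show "h \<in> ?K" using pair_eq[OF H(1)[OF h]] disj ab cd by auto
  qed
  have two: "x \<in> H \<or> y \<in> H" if "x \<in> ?K" "y \<in> ?K" "x \<noteq> y" for x y
  proof (rule ccontr)
    assume "\<not> (x \<in> H \<or> y \<in> H)"
    then have "H \<subseteq> ?K - {x, y}" using HK by auto
    then have "card H \<le> card (?K - {x, y})" by (intro card_mono) auto
    also have "\<dots> = card ?K - card {x, y}" using that by (intro card_Diff_subset) auto
    also have "\<dots> \<le> 2" using that by (simp add: card_insert_if)
    finally show False using H(2) by simp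
  qed
  have ne: "{a, c} \<noteq> {a, d}" "{a, c} \<noteq> {b, c}" "{a, c} \<noteq> {b, d}" "{a, d} \<noteq> {b, c}"
    "{a, d} \<noteq> {b, d}" "{b, c} \<noteq> {b, d}"
    using disj ab cd by (auto simp: doubleton_eq_iff)
  have E: "{a, b} \<in> G" "{b, a} \<in> G" "{c, d} \<in> G" "{d, c} \<in> G"
    using e ab cd by (auto simp: insert_commute)
  \<comment> \<open>The four instances below correspond to the four choices of the cycle edge left
    out of the path.\<close>
  note path = no_disjoint_edges_aux[of G _ _ _ _ H T, OF G(1) _ _ G(2) H(1) _ _ _ cross T]
  have "{a, c} \<notin> H \<or> {a, d} \<notin> H \<or> {b, c} \<notin> H" using path[of a b c d] E by blast
  moreover have "{a, c} \<notin> H \<or> {a, d} \<notin> H \<or> {b, d} \<notin> H" using path[of a b d c] E by blast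
  moreover have "{a, c} \<notin> H \<or> {b, c} \<notin> H \<or> {b, d} \<notin> H" using path[of b a c d] E by blast
  moreover have "{a, d} \<notin> H \<or> {b, c} \<notin> H \<or> {b, d} \<notin> H" using path[of b a d c] E by blast
  moreover have "{a, c} \<in> H \<or> {a, d} \<in> H" by (rule two[OF _ _ ne(1)]) simp_all
  moreover have "{a, c} \<in> H \<or> {b, c} \<in> H" by (rule two[OF _ _ ne(2)]) simp_all
  moreover have "{a, c} \<in> H \<or> {b, d} \<in> H" by (rule two[OF _ _ ne(3)]) simp_all
  moreover have "{a, d} \<in> H \<or> {b, c} \<in> H" by (rule two[OF _ _ ne(4)]) simp_all
  moreover have "{a, d} \<in> H \<or> {b, d} \<in> H" by (rule two[OF _ _ ne(5)]) simp_all
  moreover have "{b, c} \<in> H \<or> {b, d} \<in> H" by (rule two[OF _ _ ne(6)]) simp_all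
  ultimately show False by argo
qed

text \<open>A pairwise intersecting \<open>G\<close> is a star or a triangle. If it were a triangle,
  \<open>H\<close> would be the same triangle, and \<open>T\<close> would need at least two of its
  vertices to meet every edge but at most one to contain no edge. If it is a star, a pair avoiding
  the centre cannot meet three or more edges. In the application \<open>T\<close> is a 3-set of the
  antichain.\<close>

lemma common_vertex:
  assumes G: "\<And>e. e \<in> G \<Longrightarrow> card e = 2" "3 \<le> card G"
    and H: "\<And>h. h \<in> H \<Longrightarrow> card h = 2" "3 \<le> card H"
    and cross: "\<And>e h. e \<in> G \<Longrightarrow> h \<in> H \<Longrightarrow> e \<inter> h \<noteq> {}"
    and T: "\<And>e. e \<in> G \<Longrightarrow> \<not> e \<subseteq> T" "\<And>h. h \<in> H \<Longrightarrow> h \<inter> T \<noteq> {}"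
  shows "\<exists>x. (\<forall>e\<in>G. x \<in> e) \<and> (\<forall>h\<in>H. x \<in> h)"
proof -
  have meet: "e1 \<inter> e2 \<noteq> {}" if "e1 \<in> G" "e2 \<in> G" for e1 e2
    by (rule no_disjoint_edges[where T = T, OF G H cross T that])
  obtain e1 e2 where e: "e1 \<in> G" "e2 \<in> G" "e1 \<noteq> e2"
    using card_ge_two[of G] G(2) by auto
  obtain x where x: "x \<in> e1" "x \<in> e2" using meet[OF e(1,2)] by auto
  obtain a where a: "e1 = {x, a}" "a \<noteq> x" using G(1)[OF e(1)] x by (auto simp: card_2_iff)
  obtain b where b: "e2 = {x, b}" "b \<noteq> x" using G(1)[OF e(2)] x by (auto simp: card_2_iff)
  have "a \<noteq> b" using e(3) a b by auto
  have starG: "x \<in> f" if f: "f \<in> G" for f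
  proof (rule ccontr)
    assume "x \<notin> f"
    then have "a \<in> f" "b \<in> f" using meet[OF f e(1)] meet[OF f e(2)] a b by auto
    then have fab: "f = {a, b}" using pair_eq[OF G(1)[OF f]] \<open>a \<noteq> b\<close> by auto
    let ?K = "{{x, a}, {x, b}, {a, b}}"
    have HK: "H \<subseteq> ?K"
    proof
      fix h assume h: "h \<in> H"
      then have "x \<in> h \<or> a \<in> h" "x \<in> h \<or> b \<in> h" "a \<in> h \<or> b \<in> h"
        using cross[OF e(1) h] cross[OF e(2) h] cross[OF f h] a b fab by auto
      then show "h \<in> ?K" using pair_eq[OF H(1)[OF h]] a b \<open>a \<noteq> b\<close> by blast
    qed
    moreover have "card ?K \<le> 3" by (simp add: card_insert_if)
    ultimately have "H = ?K" using H(2) by (intro card_seteq) auto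
    then have "{x, a} \<inter> T \<noteq> {}" "{x, b} \<inter> T \<noteq> {}" "{a, b} \<inter> T \<noteq> {}" using T(2) by auto
    moreover have "\<not> {x, a} \<subseteq> T" "\<not> {x, b} \<subseteq> T" "\<not> {a, b} \<subseteq> T"
      using T(1)[OF e(1)] T(1)[OF e(2)] T(1)[OF f] a b fab by auto
    ultimately show False by blast
  qed
  have "x \<in> h" if h: "h \<in> H" for h
  proof (rule ccontr)
    assume xh: "x \<notin> h"
    have "G \<subseteq> (\<lambda>y. {x, y}) ` h"
    proof
      fix f assume f: "f \<in> G"
      then obtain y where "y \<in> f" "y \<in> h" using cross[OF f h] by auto
      then have "f = {x, y}" using pair_eq[OF G(1)[OF f] starG[OF f]] xh by metis
      then show "f \<in> (\<lambda>y. {x, y}) ` h" using \<open>y \<in> h\<close> by blast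
    qed
    moreover have "finite h" using H(1)[OF h] card.infinite by fastforce
    ultimately have "card G \<le> card h" using surj_card_le by blast
    then show False using G(2) H(1)[OF h] by simp
  qed
  then show ?thesis using starG by blast
qed

text \<open>Members through \<open>x\<close> other than pairs live in \<open>W\<close>, which has at
  most five points, so a 4-set through \<open>x\<close> omits at most one point of \<open>W\<close>.
  There are two 3-sets through \<open>x\<close>; the 4-set contains neither, so it omits a point
  common to both and different from \<open>x\<close>. Two distinct 3-sets share at most one such
  point.\<close>

lemma four_sets_through_center:
  assumes F: "F \<subseteq> Pow {1..8}" "antichain F" and two: "3 \<le> card (layer F 2)"
    and three: "3 \<le> card (layer F 3)" and six: "3 \<le> card (layer F 6)"
    and x2: "\<And>e. e \<in> layer F 2 \<Longrightarrow> x \<in> e" and x6: "\<And>A. A \<in> layer F 6 \<Longrightarrow> x \<notin> A"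
    and x: "x \<in> {1..8}"
    and Q: "Q \<in> layer F 4" "x \<in> Q" "Q' \<in> layer F 4" "x \<in> Q'"
  shows "Q = Q'"
proof -
  define L where "L = {y. {x, y} \<in> layer F 2}"
  have "layer F 2 = (\<lambda>y. {x, y}) ` L"
  proof -
    have "\<exists>y. e = {x, y}" if "e \<in> layer F 2" for e
      using x2[OF that] that by (auto simp: layer_iff card_2_iff)
    then show ?thesis unfolding L_def by blast
  qed
  moreover have "L \<subseteq> {1..8}" using in_layerD[OF F(1), of _ 2] by (fastforce simp: L_def)
  ultimately have L3: "3 \<le> card L"
    using two card_image_le[of L "\<lambda>y. {x, y}"] finite_subset[of L "{1..8}"] by auto
  define W where "W = {1..8} - L"
  have cW: "card W \<le> 5" unfolding W_def using card_compl[OF \<open>L \<subseteq> {1..8}\<close>] L3 by simp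
  have sub: "A \<subseteq> W" if "A \<in> F" "x \<in> A" "card A \<noteq> 2" for A
  proof -
    have "y \<notin> L" if "y \<in> A" for y
      using antichainD[OF F(2), of "{x, y}" A] that \<open>A \<in> F\<close> \<open>x \<in> A\<close> \<open>card A \<noteq> 2\<close>
      by (auto simp: L_def layer_iff)
    then show ?thesis using in_PowD[OF F(1) that(1)] by (auto simp: W_def)
  qed
  \<comment> \<open>Each 6-set misses \<open>x\<close> and exactly one further point;
    \<open>M\<close> collects these further points. A 3-set avoiding \<open>x\<close> lies in no
    6-set, so it must contain every point of \<open>M\<close>.\<close>
  define M where "M = {1..8} - \<Inter> (layer F 6) - {x}"
  have M: "M \<subseteq> A" if A: "A \<in> layer F 3" "x \<notin> A" for A
  proof
    fix y assume "y \<in> M"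
    then obtain B where B: "B \<in> layer F 6" "y \<notin> B" "y \<noteq> x" "y \<in> {1..8}" by (auto simp: M_def)
    have B8: "B \<subseteq> {1..8}" using in_layerD[OF F(1)] B by blast
    have "card ({1..8} - B) = 2" using card_compl[OF B8] B(1) by (simp add: layer_iff)
    then have "{1..8} - B = {x, y}" using pair_eq[of "{1..8} - B" x y] x x6[OF B(1)] B by auto
    moreover have "\<not> A \<subseteq> B"
      using antichainD[OF F(2), of A B] A(1) B(1) by (auto simp: layer_iff)
    then obtain z where "z \<in> A" "z \<notin> B" by blast
    moreover have "z \<in> {1..8}" using in_layerD[OF F(1) A(1)] \<open>z \<in> A\<close> by blast
    ultimately show "y \<in> A" using A(2) by (metis DiffI empty_iff insert_iff)
  qed
  have M3: "3 \<le> card M"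
  proof -
    have "layer F 6 \<subseteq> (\<lambda>y. {1..8} - {x, y}) ` M"
    proof
      fix B assume B: "B \<in> layer F 6"
      have B8: "B \<subseteq> {1..8}" using in_layerD[OF F(1)] B by blast
      have "card ({1..8} - B) = 2" using card_compl[OF B8] B(1) by (simp add: layer_iff)
      then obtain y where "y \<in> {1..8} - B" "y \<noteq> x" using card_ge_two[of "{1..8} - B"] by (metis order_refl)
      moreover have "x \<in> {1..8} - B" using x x6[OF B] by auto
      ultimately have y: "{1..8} - B = {x, y}" "y \<noteq> x"
        using pair_eq[OF \<open>card ({1..8} - B) = 2\<close>] by blast+
      then have "B = {1..8} - {x, y}" using B8 by blast
      moreover have "y \<in> M" using y B unfolding M_def by blast
      ultimately show "B \<in> (\<lambda>y. {1..8} - {x, y}) ` M" by blast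
    qed
    moreover have "finite M" by (simp add: M_def)
    ultimately have "card (layer F 6) \<le> card M" using surj_card_le by blast
    then show ?thesis using six by simp
  qed
  have unique: "A = M" if "A \<in> layer F 3" "x \<notin> A" for A
  proof -
    have "finite A" using finite_subset[OF in_layerD[OF F(1) that(1)]] by simp
    then show ?thesis using card_seteq[of A M] M[OF that] M3 that by (simp add: layer_iff)
  qed
  \<comment> \<open>Since \<open>M\<close> is the only possible 3-set avoiding \<open>x\<close>,
    discarding it leaves two 3-sets through \<open>x\<close>.\<close>
  have "2 \<le> card (layer F 3 - {M})" using three by (simp add: card_Diff_singleton_if) arith
  from card_ge_two[OF this] obtain T T' where T: "T \<in> layer F 3" "T' \<in> layer F 3" "T \<noteq> T'"
    "x \<in> T" "x \<in> T'" using unique by auto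
  have fin: "finite W" by (simp add: W_def)
  have cut: "\<exists>p. R = W - {p} \<and> p \<noteq> x \<and> p \<in> T \<and> p \<in> T'" if R: "R \<in> layer F 4" "x \<in> R" for R
  proof -
    have RW: "R \<subseteq> W" using sub R by (auto simp: layer_iff)
    have TW: "T \<subseteq> W" "T' \<subseteq> W" using sub T by (auto simp: layer_iff)
    have nsub: "\<not> T \<subseteq> R" "\<not> T' \<subseteq> R"
      using antichainD[OF F(2), of T R] antichainD[OF F(2), of T' R] T R by (auto simp: layer_iff)
    have "card (W - R) \<le> 1"
      using card_Diff_subset[of R W] RW fin finite_subset[OF RW] cW R by (simp add: layer_iff)
    then have single: "a = b" if "a \<in> W - R" "b \<in> W - R" for a b
      using card_le_Suc0_iff_eq[of "W - R"] fin that by simp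
    obtain p where p: "p \<in> T" "p \<notin> R" using nsub(1) by blast
    obtain p' where p': "p' \<in> T'" "p' \<notin> R" using nsub(2) by blast
    have pp: "p \<in> T'" using single[of p p'] p p' TW by blast
    have "R = W - {p}" using single[of p] p TW(1) RW by blast
    moreover have "p \<noteq> x" using p(2) R(2) by blast
    ultimately show ?thesis using p(1) pp by blast
  qed
  obtain p where p: "Q = W - {p}" "p \<noteq> x" "p \<in> T" "p \<in> T'" using cut Q by blast
  obtain q where q: "Q' = W - {q}" "q \<noteq> x" "q \<in> T" "q \<in> T'" using cut Q by blast
  have "p = q"
  proof (rule ccontr)
    assume "p \<noteq> q"
    then have "card {x, p, q} = 3" using p q by simp
    moreover have "finite T" "finite T'" using T(1,2) by (auto simp: layer_iff intro: card_ge_0_finite)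
    moreover have "card T = 3" "card T' = 3" using T(1,2) by (simp_all add: layer_iff)
    moreover have "{x, p, q} \<subseteq> T" "{x, p, q} \<subseteq> T'" using T(4,5) p(3,4) q(3,4) by simp_all
    ultimately have "{x, p, q} = T" "{x, p, q} = T'" by (simp_all add: card_seteq)
    then show False using T(3) by simp
  qed
  then show ?thesis using p q by simp
qed

lemma no_five_sizes_on_eight_points:
  assumes F: "F \<subseteq> Pow {1..8}" "multiplicity_antichain 3 F"
  shows "card (sizes F) \<noteq> 5"
proof
  assume "card (sizes F) = 5"
  moreover from this have "sizes F \<subseteq> {2..6}" using sizes_dichotomy[OF F] by simp
  ultimately have S: "sizes F = {2..6}" by (intro card_subset_eq) auto
  have ac: "antichain F" and mult: "\<And>t. t \<in> {2..6} \<Longrightarrow> 3 \<le> card (layer F t)"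
    using F S by (auto simp: multiplicity_antichain_iff)
  note co = co_subset[of 8 F] antichain_co[OF F(1) ac]
  let ?G = "layer F 2" and ?H = "layer (co 8 F) 2"
  have H: "?H = (\<lambda>A. {1..8} - A) ` layer F 6" using layer_co[OF F(1), of 2] by simp
  have comult: "3 \<le> card (layer (co 8 F) t)" if "t \<in> {2..6}" for t
  proof -
    have "t \<le> 8" "8 - t \<in> {2..6}" using that by auto
    then show ?thesis using card_layer_co[OF F(1)] mult by metis
  qed
  \<comment> \<open>Meeting the complement of a 6-set means not being contained in that 6-set, so
    the antichain property suffices for every member of another size.\<close>
  have hit: "A \<inter> h \<noteq> {}" if A: "A \<in> F" "card A \<noteq> 6" "h \<in> ?H" for A h
  proof -
    obtain B where B: "B \<in> layer F 6" "h = {1..8} - B" using A(3) H by blast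
    then have "\<not> A \<subseteq> B" using antichainD[OF ac, of A B] A by (auto simp: layer_iff)
    then show ?thesis using B in_PowD[OF F(1) A(1)] by blast
  qed
  obtain T where T: "T \<in> layer F 3" using mult[of 3] by fastforce
  have "\<exists>x. (\<forall>e\<in>?G. x \<in> e) \<and> (\<forall>h\<in>?H. x \<in> h)"
  proof (rule common_vertex)
    show "\<not> e \<subseteq> T" if "e \<in> ?G" for e
      using antichainD[OF ac, of e T] that T by (auto simp: layer_iff)
    show "h \<inter> T \<noteq> {}" if "h \<in> ?H" for h using hit[of T h] T that by (auto simp: layer_iff)
    show "e \<inter> h \<noteq> {}" if "e \<in> ?G" "h \<in> ?H" for e h
      using hit[of e h] that by (auto simp: layer_iff)
  qed (use mult[of 2] comult[of 2] in \<open>auto simp: layer_iff\<close>)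
  then obtain x where x: "\<And>e. e \<in> ?G \<Longrightarrow> x \<in> e" "\<And>h. h \<in> ?H \<Longrightarrow> x \<in> h" by blast
  have x8: "x \<in> {1..8}"
  proof -
    obtain e where "e \<in> ?G" using mult[of 2] by fastforce
    then show ?thesis using x(1)[of e] in_layerD[OF F(1), of e 2] by blast
  qed
  have x6: "x \<notin> A" if "A \<in> layer F 6" for A
    using x(2)[of "{1..8} - A"] H that by auto
  \<comment> \<open>Complementation exchanges the layers 2 and 6 and keeps the centre
    \<open>x\<close>, so \<open>four_sets_through_center\<close> will also apply to
    \<open>co 8 F\<close>, where the 4-sets avoiding \<open>x\<close> have become 4-sets through
    \<open>x\<close>.\<close>
  have x6': "x \<notin> A" if A: "A \<in> layer (co 8 F) 6" for A
  proof -
    obtain e where "e \<in> ?G" "A = {1..8} - e" using A layer_co[OF F(1), of 6] by auto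
    then show ?thesis using x(1) by blast
  qed
  have through: "Q = Q'" if "Q \<in> layer F 4" "Q' \<in> layer F 4" "x \<in> Q" "x \<in> Q'" for Q Q'
    by (rule four_sets_through_center[OF F(1) ac, of x])
      (use mult x(1) x6 x8 that in auto)
  have avoiding: "Q = Q'" if Q: "Q \<in> layer F 4" "Q' \<in> layer F 4" "x \<notin> Q" "x \<notin> Q'" for Q Q'
  proof -
    have "{1..8} - Q = {1..8} - Q'"
      by (rule four_sets_through_center[OF co, of x])
        (use comult x(2) x6' x8 Q layer_co[OF F(1), of 4] in auto)
    then show ?thesis using compl_compl[OF F(1)] Q(1,2) unfolding layer_iff by metis
  qed
  \<comment> \<open>Whether \<open>x\<close> is a member distinguishes any two 4-sets, so there are
    at most two of them.\<close>
  have "\<not> card (layer F 4) \<le> card {True, False}" using mult[of 4] by simp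
  moreover have "inj_on (\<lambda>Q. x \<in> Q) (layer F 4)"
    using through avoiding by (intro inj_onI) blast
  ultimately show False using card_inj_on_le[of "\<lambda>Q. x \<in> Q" "layer F 4" "{True, False}"] by auto
qed

subsection \<open>Constructions\<close>

text \<open>The last clause confines the sizes to the support of \<open>m\<close>; this control is
  what rules out comparabilities when families are combined. A separate bound for each size allows a
  layer with fewer than three sets to be completed later.\<close>

definition packs :: "nat \<Rightarrow> (nat \<Rightarrow> nat) \<Rightarrow> bool" where
  "packs N m \<longleftrightarrow> (\<exists>F \<subseteq> Pow {1..N}. antichain F \<and> (\<forall>t. m t \<le> card (layer F t)) \<and>
     (\<forall>A\<in>F. 0 < m (card A)))"

text \<open>Layers on which \<open>m'\<close> vanishes are discarded, as the support clause
  demands.\<close>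

lemma packs_mono:
  assumes "packs N m" "N \<le> N'" "\<And>t. m' t \<le> m t"
  shows "packs N' m'"
proof -
  obtain F where F: "F \<subseteq> Pow {1..N}" "antichain F" "\<And>t. m t \<le> card (layer F t)"
    using assms(1) by (auto simp: packs_def)
  let ?F = "{A\<in>F. 0 < m' (card A)}"
  have "m' t \<le> card (layer ?F t)" for t
  proof (cases "m' t = 0")
    case False
    then have "layer ?F t = layer F t" by (auto simp: layer_def)
    then show ?thesis using F(3)[of t] assms(3)[of t] by simp
  qed simp
  moreover have "?F \<subseteq> Pow {1..N'}" "antichain ?F" using F assms(2) by (fastforce simp: antichain_def)+
  ultimately show ?thesis unfolding packs_def by (intro exI[of _ ?F]) auto
qed

lemma packs_layer:
  assumes "k \<le> N choose t"
  shows "packs N ((\<lambda>_. 0)(t := k))"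
proof -
  have "k \<le> card {A. A \<subseteq> {1..N} \<and> card A = t}" using assms n_subsets[of "{1..N}" t] by simp
  then obtain F where F: "F \<subseteq> {A. A \<subseteq> {1..N} \<and> card A = t}" "card F = k"
    by (rule obtain_subset_with_card_n) blast
  have ac: "antichain F"
    unfolding antichain_def
  proof (intro ballI impI)
    fix A B assume AB: "A \<in> F" "B \<in> F" "A \<subseteq> B"
    then have "finite B" "card A = card B" using F(1) finite_subset[of B "{1..N}"] by auto
    then show "A = B" using card_subset_eq AB(3) by blast
  qed
  have lay: "layer F t = F" using F(1) by (auto simp: layer_def)
  have F1: "F \<subseteq> Pow {1..N}" using F(1) by blast
  have "finite F" by (rule finite_subset[OF F1]) simp
  then have "A \<in> F \<Longrightarrow> card A = t \<and> 0 < k" for A using F card_gt_0_iff by blast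
  then show ?thesis unfolding packs_def
    by (intro exI[of _ F] conjI allI ballI F1 ac) (simp_all add: lay F(2))
qed

text \<open>Without the guard \<open>t \<le> N\<close>, truncated subtraction would demand
  \<open>m 0\<close> sets of every size above \<open>N\<close>.\<close>

lemma packs_co:
  assumes "packs N m"
  shows "packs N (\<lambda>t. if t \<le> N then m (N - t) else 0)"
proof -
  obtain F where F: "F \<subseteq> Pow {1..N}" "antichain F" "\<And>t. m t \<le> card (layer F t)"
    "\<And>A. A \<in> F \<Longrightarrow> 0 < m (card A)"
    using assms by (auto simp: packs_def)
  have pos: "0 < (if card B \<le> N then m (N - card B) else 0)" if B: "B \<in> co N F" for B
  proof -
    obtain A where A: "A \<in> F" "B = {1..N} - A" using B by (auto simp: co_def)
    then have "A \<subseteq> {1..N}" using F by auto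
    then show ?thesis using A F(4)[of A] card_compl[of A N] card_le[of A N] by simp
  qed
  have large: "(if t \<le> N then m (N - t) else 0) \<le> card (layer (co N F) t)" for t
    using card_layer_co[OF F(1), of t] F(3) by simp
  show ?thesis unfolding packs_def
    by (intro exI[of _ "co N F"] conjI allI ballI co_subset antichain_co[OF F(1,2)] large pos)
qed

text \<open>Singletons of fresh points are incomparable with all nonempty sets of old points. Here
  \<open>m 0 = 0\<close> excludes the empty set, and \<open>m 1 = 0\<close> makes the new singletons
  the entire layer 1.\<close>

lemma packs_singletons:
  assumes "packs N m" "m 0 = 0" "m 1 = 0"
  shows "packs (N + k) (m(1 := k))"
proof -
  obtain F where F: "F \<subseteq> Pow {1..N}" "antichain F" "\<And>t. m t \<le> card (layer F t)"
    "\<And>A. A \<in> F \<Longrightarrow> 0 < m (card A)"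
    using assms by (auto simp: packs_def)
  let ?P = "(\<lambda>x. {x}) ` {N<..N + k}"
  let ?F = "?P \<union> F"
  have small: "card A \<noteq> 0" "card A \<noteq> 1" if "A \<in> F" for A
    using F(4)[OF that] assms by (metis less_irrefl)+
  have "layer ?F 1 = ?P" using small by (auto simp: layer_def)
  moreover have "card ?P = k" by (simp add: card_image)
  moreover have "layer ?F t = layer F t" if "t \<noteq> 1" for t using that by (auto simp: layer_def)
  ultimately have "(m(1 := k)) t \<le> card (layer ?F t)" for t using F(3) by auto
  moreover have "antichain ?F"
    unfolding antichain_def
  proof (intro ballI impI)
    fix A B assume AB: "A \<in> ?F" "B \<in> ?F" "A \<subseteq> B"
    have "A \<noteq> {}" "B \<noteq> {}" using AB(1,2) small(1) by force+
    moreover have "A \<subseteq> {1..N}" if "A \<in> F" for A using that F(1) by auto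
    ultimately show "A = B" using AB antichainD[OF F(2)] by fastforce
  qed
  moreover have "?F \<subseteq> Pow {1..N + k}" using F(1) by fastforce
  moreover have "0 < (m(1 := k)) (card A)" if "A \<in> ?F" for A
    using that F(4) small by (auto split: if_splits)
  ultimately show ?thesis unfolding packs_def by (intro exI[of _ ?F]) blast
qed

text \<open>A set through the new point \<open>Suc N\<close> is never contained in one without it.
  The reverse containment would put a member of \<open>G\<close> inside a member of
  \<open>F\<close>, which \<open>less\<close> forbids by size. The two parts are disjoint, so their
  contributions to a layer add up.\<close>

lemma packs_cone:
  assumes "packs N m1" "packs N m2" and less: "\<And>s t. 0 < m1 s \<Longrightarrow> 0 < m2 t \<Longrightarrow> s < t"
  shows "packs (Suc N) (\<lambda>t. (if t = 0 then 0 else m1 (t - 1)) + m2 t)"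
proof -
  obtain F where F: "F \<subseteq> Pow {1..N}" "antichain F" "\<And>t. m1 t \<le> card (layer F t)"
    "\<And>A. A \<in> F \<Longrightarrow> 0 < m1 (card A)"
    using assms by (auto simp: packs_def)
  obtain G where G: "G \<subseteq> Pow {1..N}" "antichain G" "\<And>t. m2 t \<le> card (layer G t)"
    "\<And>A. A \<in> G \<Longrightarrow> 0 < m2 (card A)"
    using assms by (auto simp: packs_def)
  let ?C = "insert (Suc N) ` F"
  let ?E = "?C \<union> G"
  have new: "Suc N \<notin> A" "finite A" if "A \<in> F \<union> G" for A
    using in_PowD[of "F \<union> G" "{1..N}" A] that F(1) G(1) finite_subset[of A "{1..N}"] by auto
  have disj: "?C \<inter> G = {}" using new by auto
  have inj: "inj_on (insert (Suc N)) F" using new by (intro inj_onI) (auto simp: insert_ident)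
  have layE: "layer ?E t = layer ?C t \<union> layer G t" for t by (auto simp: layer_def)
  have C: "?C \<subseteq> Pow {1..Suc N}" using in_PowD[OF F(1)] by force
  have fin: "finite (layer ?C t)" "finite (layer G t)" for t
    by (rule finite_layer[OF C], rule finite_layer[OF G(1)])
  have layC: "layer ?C t = insert (Suc N) ` layer F (t - 1)" if "t \<noteq> 0" for t
  proof -
    have "card (insert (Suc N) A) = t \<longleftrightarrow> card A = t - 1" if "A \<in> F" for A
      using new[of A] that \<open>t \<noteq> 0\<close> by auto
    then show ?thesis unfolding layer_def by blast
  qed
  have large: "(if t = 0 then 0 else m1 (t - 1)) + m2 t \<le> card (layer ?E t)" for t
  proof -
    have "card (layer ?E t) = card (layer ?C t) + card (layer G t)"
      unfolding layE using disj fin by (intro card_Un_disjoint) (auto simp: layer_def)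
    moreover have "card (layer ?C t) = card (layer F (t - 1))" if "t \<noteq> 0"
      unfolding layC[OF that] by (rule card_image, rule inj_on_subset[OF inj]) (auto simp: layer_def)
    ultimately show ?thesis using F(3)[of "t - 1"] G(3)[of t] by auto
  qed
  have ac: "antichain ?E"
    unfolding antichain_def
  proof (intro ballI impI)
    fix A B assume AB: "A \<in> ?E" "B \<in> ?E" "A \<subseteq> B"
    consider (FF) A' B' where "A' \<in> F" "B' \<in> F" "A = insert (Suc N) A'" "B = insert (Suc N) B'"
      | (GF) B' where "A \<in> G" "B' \<in> F" "B = insert (Suc N) B'"
      | (FG) "Suc N \<in> A" "B \<in> G" | (GG) "A \<in> G" "B \<in> G"
      using AB by auto
    then show "A = B"
    proof cases
      case FF
      then have "A' \<subseteq> B'" using AB(3) new(1)[of A'] new(1)[of B'] by auto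
      then show ?thesis using FF antichainD[OF F(2)] by auto
    next
      case GF
      then have "A \<subseteq> B'" using AB(3) new(1)[of A] by auto
      then have "card A \<le> card B'" using new(2)[of B'] GF by (auto intro: card_mono)
      then show ?thesis using less[OF F(4)[OF GF(2)] G(4)[OF GF(1)]] by simp
    next
      case FG
      then show ?thesis using AB(3) new(1)[of B] by auto
    next
      case GG
      then show ?thesis using AB(3) antichainD[OF G(2)] by auto
    qed
  qed
  have "G \<subseteq> Pow {1..Suc N}" by (rule order_trans[OF G(1)], rule Pow_mono) simp
  then have E: "?E \<subseteq> Pow {1..Suc N}" using C by simp
  have pos: "0 < (if card A = 0 then 0 else m1 (card A - 1)) + m2 (card A)" if A: "A \<in> ?E" for A
  proof (cases "A \<in> G")
    case True
    then show ?thesis using G(4)[OF True] by simp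
  next
    case False
    then obtain B where "B \<in> F" "A = insert (Suc N) B" using A by blast
    then show ?thesis using F(4)[of B] new[of B] by simp
  qed
  show ?thesis unfolding packs_def
    by (intro exI[of _ ?E] conjI allI ballI E ac large pos)
qed

section \<open>Intervals of sizes with three sets each, and the small cases\<close>

definition three_on :: "nat set \<Rightarrow> nat \<Rightarrow> nat" where
  "three_on S t = (if t \<in> S then 3 else 0)"

lemma packs_three_on_layer: "3 \<le> N choose t \<Longrightarrow> packs N (three_on {t})"
  by (rule packs_mono[OF packs_layer]) (auto simp: three_on_def)

lemma packs_three_on_mono: "packs N (three_on S) \<Longrightarrow> S' \<subseteq> S \<Longrightarrow> N \<le> N' \<Longrightarrow> packs N' (three_on S')"
  by (erule packs_mono) (auto simp: three_on_def)

lemma packs_three_on_singletons: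
  assumes "packs N (three_on {2..k})" "1 \<le> k"
  shows "packs (N + 3) (three_on {1..k})"
  by (rule packs_mono[OF packs_singletons[OF assms(1), of 3]]) (use assms in \<open>auto simp: three_on_def\<close>)

text \<open>The new point shifts the lower interval to end at \<open>j + 1\<close>, so an upper
  interval starting at \<open>j + 2\<close> continues it without a gap.\<close>

lemma packs_three_on_cone:
  assumes "packs N (three_on {a..j})" "packs N (three_on {j + 2..b})" "1 \<le> a"
  shows "packs (Suc N) (three_on {Suc a..b})"
  by (rule packs_mono[OF packs_cone[OF assms(1,2)]]) (use assms in \<open>auto simp: three_on_def split: if_splits\<close>)

lemma packs_three_on_co:
  assumes "packs N (three_on {a..b})" "N = a' + b" "N = b' + a" 
  shows "packs N (three_on {a'..b'})"
  by (rule packs_mono[OF packs_co[OF assms(1)]]) (use assms in \<open>auto simp: three_on_def\<close>)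

text \<open>Three singletons give the sizes \<open>1..n - 2\<close> on \<open>n + 3\<close> points,
  and complements turn these into \<open>5..n + 2\<close>. The cone over the sizes
  \<open>1..3\<close> supplies the missing \<open>2..4\<close>.\<close>

lemma packs_step_four:
  assumes "packs n (three_on {2..n - 2})" "5 \<le> n"
  shows "packs (n + 4) (three_on {2..n + 2})"
proof -
  have "packs (n + 3) (three_on {1..n - 2})"
    using packs_three_on_singletons[OF assms(1)] assms(2) by simp
  then have "packs (n + 3) (three_on {5..n + 2})"
    by (rule packs_three_on_co) (use assms in auto)
  moreover have "packs (n + 3) (three_on {1..3})"
    by (rule packs_three_on_singletons, rule packs_three_on_mono[OF assms(1)]) (use assms in auto)
  ultimately show ?thesis using packs_three_on_cone[of "n + 3" 1 3 "n + 2"]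
    by (simp add: numeral_eq_Suc)
qed

text \<open>The three pairs on three points and three further singletons give sizes 1 and 2 on six
  points, and complements give 4 and 5. This family is the source of the cases of eleven and twelve
  points.\<close>

lemma packs_seven: "packs 7 (three_on {2..5})"
proof -
  have "packs (3 + 3) (three_on {1..2})"
    by (rule packs_three_on_singletons) (use packs_three_on_layer[of 3 2] in \<open>simp_all add: numeral_eq_Suc\<close>)
  then have six: "packs 6 (three_on {1..2})" by simp
  then have "packs 6 (three_on {4..5})" by (rule packs_three_on_co) auto
  then show ?thesis using packs_three_on_cone[of 6 1 2 5] six by (simp add: numeral_eq_Suc)
qed

text \<open>On five points, the cone over singletons of four points together with the triples of
  these points has sizes 2 and 3; one step of four leads to nine.\<close>

lemma packs_nine: "packs 9 (three_on {2..7})"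
proof -
  have "packs 4 (three_on {1..1})" "packs 4 (three_on {3..3})"
    using packs_three_on_layer[of 4 1] packs_three_on_layer[of 4 3]
    by (simp_all add: numeral_eq_Suc)
  then have "packs 5 (three_on {2..3})"
    using packs_three_on_cone[of 4 1 1 3] by (simp add: numeral_eq_Suc)
  then show ?thesis using packs_step_four[of 5] by simp
qed

text \<open>The step of four would have to start from eight points, where the full range of sizes
  does not exist. Instead, the seven-point family is placed on eight points before three singletons
  are added.\<close>

lemma packs_twelve: "packs 12 (three_on {2..10})"
proof -
  have long: "packs (8 + 3) (three_on {1..5})"
    by (rule packs_three_on_singletons, rule packs_three_on_mono[OF packs_seven]) auto
  have "packs 11 (three_on {1..4})" by (rule packs_three_on_mono[OF long]) auto
  moreover have "packs 11 (three_on {6..10})"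
    by (rule packs_three_on_co[of _ 1 5]) (use long in auto)
  ultimately show ?thesis using packs_three_on_cone[of 11 1 4 10] by (simp add: numeral_eq_Suc)
qed

text \<open>On ten points both halves of the cone contribute to the middle layer.\<close>

lemma packs_ten: "packs 10 (three_on {2..8})"
proof -
  have pairs: "packs 3 (three_on {2})" by (rule packs_three_on_layer) (simp add: numeral_eq_Suc)
  have singles: "packs 5 (three_on {1})" by (rule packs_three_on_layer) simp
  have "packs (3 + 2) ((three_on {2})(1 := 2))"
    by (rule packs_singletons[OF pairs]) (simp_all add: three_on_def)
  then have five: "packs 5 ((three_on {2})(1 := 2))" by simp
  have triples: "packs 5 ((three_on {3})(4 := 2))"
    by (rule packs_mono[OF packs_co[OF five]]) (auto simp: three_on_def)
  \<comment> \<open>The cone over three singletons supplies the pairs; the sizes 3 and 4 come from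
    complements on five points, with only two 4-sets.\<close>
  have "packs (Suc 5) (\<lambda>t. (if t = 0 then 0 else three_on {1} (t - 1)) + ((three_on {3})(4 := 2)) t)"
    by (rule packs_cone[OF singles triples]) (auto simp: three_on_def split: if_splits)
  then have six: "packs 6 ((three_on {2, 3})(4 := 2))"
    by (rule packs_mono) (auto simp: three_on_def)
  have "packs (6 + 3) (((three_on {2, 3})(4 := 2))(1 := 3))"
    by (rule packs_singletons[OF six]) (simp_all add: three_on_def)
  then have nine: "packs 9 ((three_on {1..3})(4 := 2))"
    by (rule packs_mono) (auto simp: three_on_def)
  have upper: "packs 9 ((three_on {6..8})(5 := 2))"
    by (rule packs_mono[OF packs_co[OF nine]]) (auto simp: three_on_def)
  \<comment> \<open>Two sets of size 5 come from the shifted layer 4 and two from the layer 5 of the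
    upper part, together more than the three required.\<close>
  have "packs (Suc 9) (\<lambda>t. (if t = 0 then 0 else ((three_on {1..3})(4 := 2)) (t - 1)) + ((three_on {6..8})(5 := 2)) t)"
    by (rule packs_cone[OF nine upper]) (auto simp: three_on_def split: if_splits)
  then show ?thesis by (rule packs_mono) (auto simp: three_on_def)
qed

lemma packs_three_on_middle:
  "9 \<le> n \<Longrightarrow> packs n (three_on {2..n - 2})"
proof (induction n rule: less_induct)
  case (less n)
  consider "n = 9" | "n = 10" | "n = 11" | "n = 12" | "13 \<le> n" using less.prems by linarith
  then show ?case
  proof cases
    case 5
    then have "packs (n - 4 + 4) (three_on {2..n - 4 + 2})"
      using less.IH[of "n - 4"] by (intro packs_step_four) simp_all
    moreover have "n - 4 + 4 = n" "n - 4 + 2 = n - 2" using 5 by auto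
    ultimately show ?thesis by simp
  \<comment> \<open>Eleven points arise from seven by one step of four.\<close>
  qed (use packs_nine packs_ten packs_twelve packs_step_four[of 7] packs_seven in simp_all)
qed

text \<open>The support clause of \<open>packs\<close> gives \<open>sizes F \<subseteq> S\<close>;
  the lower bounds make every layer indexed by \<open>S\<close> nonempty.\<close>

lemma packs_three_on_family:
  assumes "packs n (three_on S)"
  shows "\<exists>F \<subseteq> Pow {1..n}. multiplicity_antichain 3 F \<and> sizes F = S"
proof -
  obtain F where F: "F \<subseteq> Pow {1..n}" "antichain F" "\<And>t. three_on S t \<le> card (layer F t)"
    "\<And>A. A \<in> F \<Longrightarrow> 0 < three_on S (card A)"
    using assms by (auto simp: packs_def)
  have "card A \<in> S" if "A \<in> F" for A
    using F(4)[OF that] by (simp add: three_on_def split: if_splits)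
  then have "sizes F \<subseteq> S" by (auto simp: sizes_def)
  moreover have "t \<in> sizes F" if "t \<in> S" for t
  proof -
    have "layer F t \<noteq> {}" using F(3)[of t] that by (auto simp: three_on_def)
    then show ?thesis by (auto simp: layer_def sizes_def)
  qed
  ultimately have S: "sizes F = S" by blast
  then have "multiplicity_antichain 3 F"
    unfolding multiplicity_antichain_iff using F(2,3) by (metis three_on_def)
  then show ?thesis using F(1) S by blast
qed

subsection \<open>The threshold\<close>

lemma finite_card_sizes:
  "finite {card (sizes F) | F. F \<subseteq> Pow {1..n} \<and> multiplicity_antichain r F}"
proof (rule finite_subset)
  show "{card (sizes F) | F. F \<subseteq> Pow {1..n} \<and> multiplicity_antichain r F}
    \<subseteq> (\<lambda>F. card (sizes F)) ` Pow (Pow {1..n})" by blast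
qed simp

lemma g_eq:
  assumes "9 \<le> n" shows "g n 3 = n - 3"
  unfolding g_def
proof (rule Max_eqI[OF finite_card_sizes])
  show "y \<le> n - 3" if "y \<in> {card (sizes F) | F. F \<subseteq> Pow {1..n} \<and> multiplicity_antichain 3 F}" for y
    using that card_sizes_le assms by auto
  obtain F where F: "F \<subseteq> Pow {1..n}" "multiplicity_antichain 3 F" "sizes F = {2..n - 2}"
    using packs_three_on_family[OF packs_three_on_middle[OF assms]] by blast
  have "card (sizes F) = n - 3" using assms by (simp add: F(3))
  then show "n - 3 \<in> {card (sizes F) | F. F \<subseteq> Pow {1..n} \<and> multiplicity_antichain 3 F}"
    using F by (intro CollectI exI[of _ F]) simp
qed

lemma g_eight: "g 8 3 \<noteq> 5"
proof -
  let ?K = "{card (sizes F) | F. F \<subseteq> Pow {1..8} \<and> multiplicity_antichain 3 F}"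
  \<comment> \<open>The empty family makes \<open>?K\<close> nonempty, so that its
    \<open>Max\<close> is one of its elements.\<close>
  have "multiplicity_antichain 3 {}" by (simp add: multiplicity_antichain_def sizes_def)
  then have "?K \<noteq> {}" by blast
  then have "g 8 3 \<in> ?K" unfolding g_def by (rule Max_in[OF finite_card_sizes])
  then show ?thesis using no_five_sizes_on_eight_points by force
qed

text \<open>The first conjunct ensures that the \<open>LEAST\<close> in \<open>n0\<close> ranges
  over a nonempty set. Minimality holds because a threshold below 8 would force \<open>g 8 3\<close>
  to be 5.\<close>

theorem theoremA4:
  "(\<exists>m. threshold 3 m) \<and> n0 3 = 8"
proof -
  have eight: "threshold 3 8" by (simp add: threshold_def g_eq)
  moreover have "8 \<le> m" if "threshold 3 m" for m
  proof (rule ccontr)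
    assume "\<not> 8 \<le> m"
    then have "int (g 8 3) = int 8 - 3" using that unfolding threshold_def by simp
    then show False using g_eight by simp
  qed
  ultimately have "n0 3 = 8" unfolding n0_def by (rule Least_equality)
  then show ?thesis using eight by blast
qed

end
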